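(* Let $f\colon 2^{[n]}\to\mathbb{R}$ be an irreducible supermodular function. Then the complexity of $f$ is at most $2^{n^22^n}$.
   Context: A function $f\colon 2^{[n]}\to\mathbb{R}$ is supermodular if $f(I\cap J)+f(I\cup J)\ge f(I)+f(J)$ for all $I,J$, modular if equality always holds; supermodular $f$ is irreducible if it is not modular and whenever $f=g_1+g_2$ with $g_i$ supermodular, each $g_i$ differs from some $c_if$, $c_i\ge0$, by a modular function. An unordered pair $\{I,J\}$ of subsets of $[n]$ is close if $|I|=|J|=|I\cap J|+1=|I\cup J|-1$; $\mathcal{P}_n$ is the set of close pairs and $Tf\in\mathbb{R}^{\mathcal{P}_n}$ is given by $(Tf)_{I,J}=f(I\cap J)+f(I\cup J)-f(I)-f(J)$. For $\sigma\in S_n$ and $1\le r\le n-1$ let $I_r(\sigma)=\{\sigma_1,\dots,\sigma_r\}$, $J_r(\sigma)=\{\sigma_2,\dots,\sigma_{r+1}\}$ and $P_\sigma(s)=\sum_{r=1}^{n-1}s_{I_r(\sigma),J_r(\sigma)}$. For $s\in\operatorname{im}T$ there are reals $m_1,\dots,m_n$ (the weights of the colors $1,\dots,n$) with $P_\sigma(s)=m_{\sigma_1}$ for all $\sigma\in S_n$. The complexity of an irreducible supermodular $f$ is $\max_i m_i$ computed for $s=c\,Tf$, where $c>0$ is chosen so that $c\,Tf$ has integer entries with no common factor. *)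

theory Defs
  imports Complex_Main "HOL-Combinatorics.Permutations"
begin

text \<open>
  A function on the subsets of \<open>[n] = {1..n}\<close> is a total function \<open>nat set \<Rightarrow> real\<close> of which only the
  values on \<open>Pow {1..n}\<close> are ever used; in particular all identities between functions are required
  on \<open>Pow {1..n}\<close> only.
\<close>

definition supermodular :: "nat \<Rightarrow> (nat set \<Rightarrow> real) \<Rightarrow> bool" where
  "supermodular n f \<longleftrightarrow>
     (\<forall>I\<in>Pow {1..n}. \<forall>J\<in>Pow {1..n}. f (I \<inter> J) + f (I \<union> J) \<ge> f I + f J)"

definition modular :: "nat \<Rightarrow> (nat set \<Rightarrow> real) \<Rightarrow> bool" where
  "modular n f \<longleftrightarrow>
     (\<forall>I\<in>Pow {1..n}. \<forall>J\<in>Pow {1..n}. f (I \<inter> J) + f (I \<union> J) = f I + f J)"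

definition irreducible_supermodular :: "nat \<Rightarrow> (nat set \<Rightarrow> real) \<Rightarrow> bool" where
  "irreducible_supermodular n f \<longleftrightarrow>
     supermodular n f \<and> \<not> modular n f \<and>
     (\<forall>g\<^sub>1 g\<^sub>2. supermodular n g\<^sub>1 \<and> supermodular n g\<^sub>2 \<and>
        (\<forall>I\<in>Pow {1..n}. f I = g\<^sub>1 I + g\<^sub>2 I) \<longrightarrow>
        (\<exists>c\<^sub>1\<ge>0. modular n (\<lambda>I. g\<^sub>1 I - c\<^sub>1 * f I)) \<and>
        (\<exists>c\<^sub>2\<ge>0. modular n (\<lambda>I. g\<^sub>2 I - c\<^sub>2 * f I)))"

text \<open>
  The unordered pair of \<open>I\<close> and \<open>J\<close> is the set \<open>{I, J}\<close>; the members of a close pair are distinct.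
  Vectors indexed by \<open>close_pairs n\<close> are functions \<open>nat set set \<Rightarrow> real\<close>.
\<close>

definition close_pairs :: "nat \<Rightarrow> nat set set set" where
  "close_pairs n =
     {{I, J} | I J. I \<subseteq> {1..n} \<and> J \<subseteq> {1..n} \<and>
        card I = card J \<and> card I = card (I \<inter> J) + 1 \<and> card I + 1 = card (I \<union> J)}"

definition Tmap :: "(nat set \<Rightarrow> real) \<Rightarrow> nat set set \<Rightarrow> real" where
  "Tmap f p = f (\<Inter>p) + f (\<Union>p) - (\<Sum>K\<in>p. f K)"

lemma Tmap_pair: "I \<noteq> J \<Longrightarrow> Tmap f {I, J} = f (I \<inter> J) + f (I \<union> J) - f I - f J"
  by (simp add: Tmap_def)

definition I_set :: "(nat \<Rightarrow> nat) \<Rightarrow> nat \<Rightarrow> nat set" where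
  "I_set \<sigma> r = \<sigma> ` {1..r}"

definition J_set :: "(nat \<Rightarrow> nat) \<Rightarrow> nat \<Rightarrow> nat set" where
  "J_set \<sigma> r = \<sigma> ` {2..r + 1}"

definition P_sum :: "nat \<Rightarrow> (nat \<Rightarrow> nat) \<Rightarrow> (nat set set \<Rightarrow> real) \<Rightarrow> real" where
  "P_sum n \<sigma> s = (\<Sum>r=1..n - 1. s {I_set \<sigma> r, J_set \<sigma> r})"

text \<open>
  For \<open>s\<close> in the image of \<open>T\<close> and \<open>i \<in> [n]\<close> the weight is well defined by \<open>P_sum_Tmap\<close> below.
\<close>

definition weight :: "nat \<Rightarrow> (nat set set \<Rightarrow> real) \<Rightarrow> nat \<Rightarrow> real" where
  "weight n s i = (THE m. \<forall>\<sigma>. \<sigma> permutes {1..n} \<and> \<sigma> 1 = i \<longrightarrow> P_sum n \<sigma> s = m)"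

definition primitive_integral :: "nat \<Rightarrow> (nat set set \<Rightarrow> real) \<Rightarrow> bool" where
  "primitive_integral n s \<longleftrightarrow>
     (\<forall>p\<in>close_pairs n. s p \<in> \<int>) \<and> Gcd ((\<lambda>p. \<lfloor>s p\<rfloor>) ` close_pairs n) = 1"

text \<open>
  The scaling factor is unique whenever it exists (\<open>primitive_scaling_unique\<close> below).  It exists for
  irreducible \<open>f\<close>, since \<open>Tmap f\<close> then spans an extreme ray of a rational polyhedral cone.
\<close>

definition scaling :: "nat \<Rightarrow> (nat set \<Rightarrow> real) \<Rightarrow> real" where
  "scaling n f = (THE c. c > 0 \<and> primitive_integral n (\<lambda>p. c * Tmap f p))"

definition complexity :: "nat \<Rightarrow> (nat set \<Rightarrow> real) \<Rightarrow> real" where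
  "complexity n f = Max (weight n (\<lambda>p. scaling n f * Tmap f p) ` {1..n})"

lemma I_J_set_pair:
  assumes \<sigma>: "\<sigma> permutes {1..n}" and r: "1 \<le> r" "r < n"
  shows "{I_set \<sigma> r, J_set \<sigma> r} \<in> close_pairs n"
    and "Tmap f {I_set \<sigma> r, J_set \<sigma> r} =
           f (J_set \<sigma> (r - 1)) + f (I_set \<sigma> (r + 1)) - f (I_set \<sigma> r) - f (J_set \<sigma> r)"
proof -
  have inj: "inj \<sigma>" using \<sigma> by (rule permutes_inj)
  have c: "card (\<sigma> ` A) = card A" for A
    using inj by (meson card_image inj_on_subset subset_UNIV)
  have int: "I_set \<sigma> r \<inter> J_set \<sigma> r = \<sigma> ` {2..r}"
    unfolding I_set_def J_set_def using inj r
    by (subst image_Int[symmetric]) (auto intro!: arg_cong[where f = "image \<sigma>"])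
  have un: "I_set \<sigma> r \<union> J_set \<sigma> r = \<sigma> ` {1..r + 1}"
    unfolding I_set_def J_set_def image_Un[symmetric] using r
    by (intro arg_cong[where f = "image \<sigma>"]) auto
  have sub: "\<sigma> ` A \<subseteq> {1..n}" if "A \<subseteq> {1..n}" for A
    using permutes_image[OF \<sigma>] that by blast
  have subs: "I_set \<sigma> r \<subseteq> {1..n}" "J_set \<sigma> r \<subseteq> {1..n}"
    unfolding I_set_def J_set_def using r by (intro sub; auto)+
  have card: "card (I_set \<sigma> r) = r" "card (J_set \<sigma> r) = r"
    "card (I_set \<sigma> r \<inter> J_set \<sigma> r) = r - 1" "card (I_set \<sigma> r \<union> J_set \<sigma> r) = r + 1"
    unfolding int un by (simp_all add: I_set_def J_set_def c)
  show "{I_set \<sigma> r, J_set \<sigma> r} \<in> close_pairs n"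
    unfolding close_pairs_def mem_Collect_eq using subs card r
    by (intro exI[of _ "I_set \<sigma> r"] exI[of _ "J_set \<sigma> r"]) simp
  have ne: "I_set \<sigma> r \<noteq> J_set \<sigma> r" using card r by auto
  show "Tmap f {I_set \<sigma> r, J_set \<sigma> r} =
      f (J_set \<sigma> (r - 1)) + f (I_set \<sigma> (r + 1)) - f (I_set \<sigma> r) - f (J_set \<sigma> r)"
    unfolding Tmap_pair[OF ne] int un using r by (simp add: I_set_def J_set_def)
qed

lemma P_sum_Tmap:
  assumes \<sigma>: "\<sigma> permutes {1..n}" and n: "n \<ge> 1"
  shows "P_sum n \<sigma> (Tmap f) = f {1..n} + f {} - f {\<sigma> 1} - f ({1..n} - {\<sigma> 1})"
proof -
  have tel: "(\<Sum>r=1..k. f (J_set \<sigma> (r - 1)) + f (I_set \<sigma> (r + 1)) - f (I_set \<sigma> r) - f (J_set \<sigma> r))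
      = f (I_set \<sigma> (k + 1)) + f (J_set \<sigma> 0) - f (I_set \<sigma> 1) - f (J_set \<sigma> k)" for k
    by (induction k) auto
  have "P_sum n \<sigma> (Tmap f) = (\<Sum>r=1..n - 1.
      f (J_set \<sigma> (r - 1)) + f (I_set \<sigma> (r + 1)) - f (I_set \<sigma> r) - f (J_set \<sigma> r))"
    unfolding P_sum_def using I_J_set_pair(2)[OF \<sigma>] n by (intro sum.cong) auto
  also have "\<dots> = f (I_set \<sigma> n) + f (J_set \<sigma> 0) - f (I_set \<sigma> 1) - f (J_set \<sigma> (n - 1))"
    using n by (simp only: tel) simp
  also have "I_set \<sigma> n = {1..n}" using permutes_image[OF \<sigma>] by (simp add: I_set_def)
  also have "J_set \<sigma> (n - 1) = \<sigma> ` ({1..n} - {1})"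
    unfolding J_set_def using n by (intro arg_cong[where f = "image \<sigma>"]) auto
  also have "\<dots> = {1..n} - {\<sigma> 1}"
    using permutes_image[OF \<sigma>] by (simp add: image_set_diff[OF permutes_inj[OF \<sigma>]])
  finally show ?thesis by (simp add: I_set_def J_set_def)
qed

lemma weight_Tmap:
  assumes \<sigma>: "\<sigma> permutes {1..n}" and n: "n \<ge> 1"
  shows "weight n (Tmap f) (\<sigma> 1) = P_sum n \<sigma> (Tmap f)"
  unfolding weight_def using \<sigma> n by (intro the_equality) (auto simp: P_sum_Tmap)

lemma primitive_scaling_unique:
  assumes "c > 0" "primitive_integral n (\<lambda>p. c * Tmap f p)"
    and "d > 0" "primitive_integral n (\<lambda>p. d * Tmap f p)"
  shows "c = d"
proof -
  define A where "A = (\<lambda>p. \<lfloor>c * Tmap f p\<rfloor>)"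
  define B where "B = (\<lambda>p. \<lfloor>d * Tmap f p\<rfloor>)"
  let ?P = "close_pairs n"
  have A: "c * Tmap f p = of_int (A p)" and B: "d * Tmap f p = of_int (B p)" if "p \<in> ?P" for p
    using assms(2,4) that unfolding primitive_integral_def A_def B_def by auto
  have gA: "Gcd (A ` ?P) = 1" and gB: "Gcd (B ` ?P) = 1"
    using assms(2,4) unfolding primitive_integral_def A_def B_def by auto
  have "\<exists>p\<in>?P. A p \<noteq> 0"
  proof (rule ccontr)
    assume "\<not> ?thesis"
    then have "Gcd (A ` ?P) = 0" by (simp add: Gcd_0_iff image_subset_iff)
    with gA show False by simp
  qed
  then obtain q where q: "q \<in> ?P" "A q \<noteq> 0" by blast
  define a b where "a = \<bar>A q\<bar>" and "b = \<bar>B q\<bar>"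
  have eq: "b * A p = a * B p" if p: "p \<in> ?P" for p
  proof -
    have "\<bar>d * Tmap f q\<bar> * (c * Tmap f p) = \<bar>c * Tmap f q\<bar> * (d * Tmap f p)"
      using assms(1,3) by (simp add: abs_mult)
    then have "real_of_int (b * A p) = of_int (a * B p)"
      unfolding a_def b_def using A B p q by simp
    then show ?thesis by (simp only: of_int_eq_iff)
  qed
  have "Gcd ((*) b ` A ` ?P) = b" "Gcd ((*) a ` B ` ?P) = a"
    by (simp_all add: Gcd_mult gA gB a_def b_def)
  moreover have "(*) b ` A ` ?P = (*) a ` B ` ?P"
    unfolding image_image using eq by (intro image_cong) auto
  ultimately have ab: "a = b" by simp
  have "\<bar>c * Tmap f q\<bar> = \<bar>d * Tmap f q\<bar>"
    using ab unfolding a_def b_def A[OF q(1)] B[OF q(1)] by (metis of_int_abs)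
  moreover have "Tmap f q \<noteq> 0" using A[OF q(1)] q(2) by auto
  ultimately show ?thesis using assms(1,3) by (simp add: abs_mult)
qed

end

theory Submission
  imports Defs "HOL-Library.FuncSet" "HOL-Library.Function_Algebras"
begin

text \<open>
  Normalise \<open>f\<close> to vanish on the empty set and on singletons.  Irreducibility says that it is then,
  up to scaling, the only function on \<open>Pow {1..n}\<close> with this vanishing and with \<open>Tmap\<close> zero on the
  close pairs where \<open>Tmap f\<close> is zero.  These conditions form a homogeneous integer system whose rows
  have \<open>l\<^sub>1\<close>-norm at most 4, and at most \<open>2 ^ n - 1\<close> of them are independent, so Siegel's pigeonhole
  argument gives a nonzero integer solution with entries at most \<open>4 ^ (2 ^ n - 1)\<close>.  The primitive
  scaling of \<open>Tmap f\<close> is no larger than this solution, and each weight is a difference of two of its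
  entries.
\<close>

section \<open>Small integer solutions of homogeneous systems\<close>

text \<open>The box of vectors with entries in \<open>{0..B}\<close> on \<open>S\<close> has more
  points than the rows of \<open>R\<close> have joint values on it. Two points with equal row values
  differ by a solution with entries of absolute value at most \<open>B\<close>.\<close>

lemma Siegel_pigeonhole:
  fixes R :: "('a \<Rightarrow> int) set" and L :: nat
  assumes S: "finite S" and R: "finite R" "card R < card S"
    and L: "L \<ge> 1" "\<And>r. r \<in> R \<Longrightarrow> (\<Sum>s\<in>S. \<bar>r s\<bar>) \<le> int L"
  obtains x :: "'a \<Rightarrow> int" where "\<exists>s\<in>S. x s \<noteq> 0"
    "\<And>s. s \<in> S \<Longrightarrow> \<bar>x s\<bar> \<le> int (L ^ (card S - 1))"
    "\<And>r. r \<in> R \<Longrightarrow> (\<Sum>s\<in>S. r s * x s) = 0"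
proof -
  define B where "B = L ^ (card S - 1)"
  define X where "X = S \<rightarrow>\<^sub>E {0..int B}"
  \<comment> \<open>The least value of row \<open>r\<close> on the box: entries \<open>B\<close> at
    negative coefficients, \<open>0\<close> elsewhere. The greatest value exceeds it by the
    \<open>l1\<close>-norm of \<open>r\<close> on \<open>S\<close> times \<open>B\<close>, hence by
    at most \<open>L * B\<close>.\<close>
  define lo where "lo r = (\<Sum>s\<in>S. min (r s) 0) * int B" for r :: "'a \<Rightarrow> int"
  define Y where "Y = (\<Pi>\<^sub>E r\<in>R. {lo r..lo r + int (L * B)})"
  define \<Phi> where "\<Phi> x = (\<lambda>r\<in>R. \<Sum>s\<in>S. r s * x s)" for x :: "'a \<Rightarrow> int"
  have cardX: "card X = (B + 1) ^ card S"
    unfolding X_def using S by (simp add: card_PiE nat_add_distrib)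
  have cardY: "card Y = (L * B + 1) ^ card R"
    unfolding Y_def using R by (simp add: card_PiE nat_add_distrib nat_mult_distrib)
  have finY: "finite Y" unfolding Y_def using R by (intro finite_PiE) auto
  have "\<Phi> ` X \<subseteq> Y"
  proof clarify
    fix x assume x: "x \<in> X"
    have bx: "0 \<le> x s" "x s \<le> int B" if "s \<in> S" for s
      using x that unfolding X_def by (auto simp: PiE_iff)
    have "lo r \<le> (\<Sum>s\<in>S. r s * x s)" "(\<Sum>s\<in>S. r s * x s) \<le> lo r + int (L * B)" if r: "r \<in> R" for r
    proof -
      show "lo r \<le> (\<Sum>s\<in>S. r s * x s)"
        unfolding lo_def sum_distrib_right
      proof (rule sum_mono)
        fix s assume s: "s \<in> S"
        show "min (r s) 0 * int B \<le> r s * x s"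
          using bx[OF s] by (cases "r s \<ge> 0") (auto simp: min_def intro: mult_left_mono_neg)
      qed
      have "(\<Sum>s\<in>S. r s * x s) \<le> (\<Sum>s\<in>S. min (r s) 0 * int B + \<bar>r s\<bar> * int B)"
      proof (rule sum_mono)
        fix s assume s: "s \<in> S"
        show "r s * x s \<le> min (r s) 0 * int B + \<bar>r s\<bar> * int B"
          using bx[OF s]
          by (cases "r s \<ge> 0") (auto simp: min_def mult_left_mono mult_nonpos_nonneg)
      qed
      also have "\<dots> = lo r + (\<Sum>s\<in>S. \<bar>r s\<bar>) * int B"
        by (simp add: lo_def sum.distrib sum_distrib_right)
      also have "\<dots> \<le> lo r + int (L * B)"
        using L(2)[OF r] by (simp add: mult_right_mono)
      finally show "(\<Sum>s\<in>S. r s * x s) \<le> lo r + int (L * B)" .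
    qed
    then show "\<Phi> x \<in> Y" by (auto simp: \<Phi>_def Y_def)
  qed
  then have "card (\<Phi> ` X) \<le> card Y" using finY by (rule card_mono[rotated])
  also have "card Y \<le> (L * (B + 1)) ^ card R"
    unfolding cardY using L(1) by (intro power_mono) (simp_all add: algebra_simps)
  also have "\<dots> \<le> (L * (B + 1)) ^ (card S - 1)"
    using L(1) R(2) by (intro power_increasing) auto
  \<comment> \<open>The choice of \<open>B\<close> pays off here: \<open>L ^ (card S - 1)\<close> is
    \<open>B\<close> itself, just below the remaining factor \<open>B + 1\<close> of
    \<open>card X\<close>.\<close>
  also have "\<dots> = B * (B + 1) ^ (card S - 1)" by (simp only: power_mult_distrib B_def)
  also have "\<dots> < (B + 1) * (B + 1) ^ (card S - 1)" by simp
  also have "\<dots> = card X" unfolding cardX using R(2) by (cases "card S") auto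
  finally have "\<not> inj_on \<Phi> X" by (rule pigeonhole)
  then obtain x y where xy: "x \<in> X" "y \<in> X" "x \<noteq> y" "\<Phi> x = \<Phi> y"
    unfolding inj_on_def by blast
  show thesis
  proof (rule that[of "\<lambda>s. x s - y s"])
    show "\<exists>s\<in>S. x s - y s \<noteq> 0"
      using xy(3) PiE_ext[OF xy(1,2)[unfolded X_def]] by (metis right_minus_eq)
    show "\<bar>x s - y s\<bar> \<le> int (L ^ (card S - 1))" if "s \<in> S" for s
    proof -
      have "x s \<in> {0..int B}" "y s \<in> {0..int B}"
        using xy(1,2) that unfolding X_def by (auto simp: PiE_iff)
      then show ?thesis unfolding B_def by auto
    qed
    show "(\<Sum>s\<in>S. r s * (x s - y s)) = 0" if "r \<in> R" for r
      using fun_cong[OF xy(4), of r] that by (simp add: \<Phi>_def right_diff_distrib sum_subtractf)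
  qed
qed

text \<open>The number of rows is irrelevant, and \<open>R\<close> may be infinite: only a maximal
  independent set of rows matters, and the nonzero real solution \<open>f\<close> keeps its size
  below \<open>card S\<close>, as the pigeonhole argument demands.\<close>

lemma small_integer_solution:
  fixes R :: "('a \<Rightarrow> int) set" and L :: nat and f :: "'a \<Rightarrow> real"
  assumes S: "finite S"
    and L: "L \<ge> 1" "\<And>r. r \<in> R \<Longrightarrow> (\<Sum>s\<in>S. \<bar>r s\<bar>) \<le> int L"
    and f: "\<exists>s\<in>S. f s \<noteq> 0" "\<And>r. r \<in> R \<Longrightarrow> (\<Sum>s\<in>S. real_of_int (r s) * f s) = 0"
  obtains x :: "'a \<Rightarrow> int" where "\<exists>s\<in>S. x s \<noteq> 0"
    "\<And>s. s \<in> S \<Longrightarrow> \<bar>x s\<bar> \<le> int (L ^ (card S - 1))"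
    "\<And>r. r \<in> R \<Longrightarrow> (\<Sum>s\<in>S. r s * x s) = 0"
proof -
  interpret vector_space "\<lambda>(c::real) (v::'a \<Rightarrow> real) s. c * v s"
    by unfold_locales (auto simp: fun_eq_iff algebra_simps)
  \<comment> \<open>Values outside \<open>S\<close> are set to \<open>0\<close>, so that all vectors
    lie in the span of the \<open>card S\<close> unit vectors \<open>E\<close> and linear dependence
    sees \<open>S\<close> only.\<close>
  define res where "res v = (\<lambda>s. if s \<in> S then v s else 0)" for v :: "'a \<Rightarrow> real"
  define \<rho> where "\<rho> r = res (\<lambda>s. real_of_int (r s))" for r :: "'a \<Rightarrow> int"
  define E where "E = (\<lambda>t s. of_bool (s = t) :: real) ` S"
  have ortho: "(\<Sum>s\<in>S. v s * g s) = 0" if "v \<in> span V" "\<And>w. w \<in> V \<Longrightarrow> (\<Sum>s\<in>S. w s * g s) = 0"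
    for v V g
    using that(1)
    by (induction rule: span_induct_alt)
       (auto simp: that(2) algebra_simps sum.distrib simp flip: sum_distrib_left)
  have res_span: "res v \<in> span E" for v
  proof -
    have sum_apply: "(\<Sum>t\<in>T. F t) s = (\<Sum>t\<in>T. F t s)" if "finite T"
      for T and F :: "'a \<Rightarrow> 'a \<Rightarrow> real" and s
      using that by (induction T rule: finite_induct) simp_all
    have "res v = (\<Sum>t\<in>S. (\<lambda>s. v t * of_bool (s = t)))"
    proof
      show "res v s = (\<Sum>t\<in>S. (\<lambda>s. v t * of_bool (s = t))) s" for s
        unfolding sum_apply[OF S]
        using S by (simp add: res_def of_bool_def if_distrib[of "\<lambda>x. _ * x"] cong: if_cong)
    qed
    also have "\<dots> \<in> span E"
      by (intro span_sum span_scale span_base) (auto simp: E_def)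
    finally show ?thesis .
  qed
  obtain V where V: "V \<subseteq> \<rho> ` R" "independent V" "\<rho> ` R \<subseteq> span V"
    by (rule maximal_independent_subset)
  have fV: "(\<Sum>s\<in>S. w s * res f s) = 0" if "w \<in> V" for w
    using that V(1) f(2) by (auto simp: \<rho>_def res_def cong: sum.cong)
  \<comment> \<open>A nonzero vector orthogonal to all rows leaves room for fewer than \<open>card S\<close> independent rows.\<close>
  have "res f \<notin> span V"
  \<comment> \<open>Otherwise \<open>res f\<close> would be orthogonal to itself.\<close>
  proof
    assume "res f \<in> span V"
    then have "(\<Sum>s\<in>S. res f s * res f s) = 0" using fV by (rule ortho)
    then have "\<forall>s\<in>S. res f s * res f s = 0" using S by (subst (asm) sum_nonneg_eq_0_iff) auto
    with f(1) show False by (auto simp: res_def)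
  qed
  then have indep: "independent (insert (res f) V)" and notin: "res f \<notin> V"
    using V(2) by (auto simp: independent_insert span_base)
  have "insert (res f) V \<subseteq> span E" using V(1) res_span by (auto simp: \<rho>_def)
  moreover have "finite E" "card E \<le> card S" unfolding E_def using S by (auto intro: card_image_le)
  ultimately have finV: "finite V" and cardV: "card V < card S"
    using independent_span_bound[OF _ indep] notin by force+
  \<comment> \<open>Distinct rows may agree on \<open>S\<close>, so one integer row is chosen for
    each vector of \<open>V\<close>.\<close>
  obtain R0 where R0: "R0 \<subseteq> R" "inj_on \<rho> R0" "V = \<rho> ` R0"
    using V(1) by (meson subset_image_inj)
  have "finite R0" "card R0 < card S"
    using finV cardV R0 by (auto simp: finite_image_iff card_image)
  then obtain x where x: "\<exists>s\<in>S. x s \<noteq> 0" "\<And>s. s \<in> S \<Longrightarrow> \<bar>x s\<bar> \<le> int (L ^ (card S - 1))"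
      "\<And>r. r \<in> R0 \<Longrightarrow> (\<Sum>s\<in>S. r s * x s) = 0"
    using L R0(1) by (elim Siegel_pigeonhole[OF S, of R0 L]) auto
  have eq: "(\<Sum>s\<in>S. \<rho> r s * real_of_int (x s)) = of_int (\<Sum>s\<in>S. r s * x s)" for r
    by (simp add: \<rho>_def res_def)
  have "(\<Sum>s\<in>S. r s * x s) = 0" if "r \<in> R" for r
  proof -
    have "(\<Sum>s\<in>S. \<rho> r s * real_of_int (x s)) = 0"
      by (rule ortho[of _ V]) (use that V(3) R0(3) x(3) in \<open>auto simp only: eq\<close>)
    then show ?thesis unfolding eq by (simp only: of_int_eq_0_iff)
  qed
  with x show thesis by (intro that)
qed

section \<open>Close pairs and local criteria for supermodularity and modularity\<close>

text \<open>The cardinalities leave exactly one element in each of \<open>I - J\<close> and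
  \<open>J - I\<close>. With \<open>K\<close> as the intersection, \<open>Tmap\<close> at the pair
  becomes a mixed second difference at \<open>K\<close> in the directions \<open>a\<close> and
  \<open>b\<close>.\<close>

lemma close_pairsE:
  assumes "p \<in> close_pairs n"
  obtains K a b where "a \<noteq> b" "a \<notin> K" "b \<notin> K" "insert a (insert b K) \<subseteq> {1..n}"
    "p = {insert a K, insert b K}"
proof -
  obtain I J where IJ: "p = {I, J}" "I \<subseteq> {1..n}" "J \<subseteq> {1..n}" "card I = card J"
      "card I = card (I \<inter> J) + 1"
    using assms unfolding close_pairs_def by blast
  have fin: "finite I" "finite J" using IJ(2,3) finite_subset by blast+
  have "card (I - J) = 1" "card (J - I) = 1"
    using IJ(4,5) fin by (simp_all add: card_Diff_subset_Int Int_commute)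
  then obtain a b where ab: "I - J = {a}" "J - I = {b}" by (meson card_1_singletonE)
  show thesis
    by (rule that[of a b "I \<inter> J"]) (use ab IJ in auto)
qed

lemma insert_pair_close:
  assumes "a \<noteq> b" "a \<notin> K" "b \<notin> K" "insert a (insert b K) \<subseteq> {1..n}"
  shows "{insert a K, insert b K} \<in> close_pairs n"
    and "Tmap g {insert a K, insert b K} =
      g K + g (insert a (insert b K)) - g (insert a K) - g (insert b K)"
proof -
  have K: "finite K" using assms(4) finite_subset by auto
  have int: "insert a K \<inter> insert b K = K" and un: "insert a K \<union> insert b K = insert a (insert b K)"
    using assms by auto
  show "{insert a K, insert b K} \<in> close_pairs n"
    unfolding close_pairs_def mem_Collect_eq
    by (intro exI[of _ "insert a K"] exI[of _ "insert b K"]) (use assms K int un in auto)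
  have "insert a K \<noteq> insert b K" using assms by auto
  then show "Tmap g {insert a K, insert b K} =
      g K + g (insert a (insert b K)) - g (insert a K) - g (insert b K)"
    using Tmap_pair[of "insert a K" "insert b K" g] unfolding int un by blast
qed

lemma finite_close_pairs: "finite (close_pairs n)"
proof (rule finite_subset)
  show "close_pairs n \<subseteq> Pow (Pow {1..n})" by (auto simp: close_pairs_def)
qed simp

lemma Tmap_linear:
  assumes "p \<in> close_pairs n"
  shows "Tmap (\<lambda>K. a * f K + b * g K) p = a * Tmap f p + b * Tmap g p"
proof -
  obtain K x y where *: "x \<noteq> y" "x \<notin> K" "y \<notin> K" "insert x (insert y K) \<subseteq> {1..n}"
    and p: "p = {insert x K, insert y K}" using assms by (rule close_pairsE)
  show ?thesis unfolding p insert_pair_close(2)[OF *] by (simp add: algebra_simps)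
qed

text \<open>From local to global: nonnegative second differences make increments grow with the base
  set. Comparing the increment by \<open>I - J\<close> over the bases \<open>I \<inter> J\<close>
  and \<open>J\<close> then gives the full inequality.\<close>

lemma supermodular_iff_Tmap_nonneg:
  "supermodular n g \<longleftrightarrow> (\<forall>p\<in>close_pairs n. Tmap g p \<ge> 0)"
proof
  assume sm: "supermodular n g"
  show "\<forall>p\<in>close_pairs n. Tmap g p \<ge> 0"
  proof
    fix p assume "p \<in> close_pairs n"
    then obtain K a b where p: "a \<noteq> b" "a \<notin> K" "b \<notin> K" "insert a (insert b K) \<subseteq> {1..n}"
      "p = {insert a K, insert b K}" by (rule close_pairsE)
    have "g (insert a K \<inter> insert b K) + g (insert a K \<union> insert b K) \<ge> g (insert a K) + g (insert b K)"
      using sm p(4) unfolding supermodular_def by blast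
    moreover have "insert a K \<inter> insert b K = K" "insert a K \<union> insert b K = insert a (insert b K)"
      using p by auto
    ultimately show "Tmap g p \<ge> 0" by (simp add: p(5) insert_pair_close(2)[OF p(1-4)])
  qed
next
  assume T: "\<forall>p\<in>close_pairs n. Tmap g p \<ge> 0"
  \<comment> \<open>The base \<open>A\<close> is enlarged by one element of \<open>D\<close> at a
    time; each enlargement is one close pair inequality.\<close>
  have one: "g (insert a A) - g A \<le> g (insert a (A \<union> D)) - g (A \<union> D)"
    if "finite D" "A \<union> D \<subseteq> {1..n}" "a \<in> {1..n}" "a \<notin> A \<union> D" for a A D
    using that
  proof (induction D rule: finite_induct)
    case (insert b D)
    show ?case
    proof (cases "b \<in> A")
      case True
      then have "A \<union> insert b D = A \<union> D" by auto
      then show ?thesis using insert by auto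
    next
      case False
      then have *: "b \<noteq> a" "b \<notin> A \<union> D" "a \<notin> A \<union> D" "insert b (insert a (A \<union> D)) \<subseteq> {1..n}"
        using insert by auto
      show ?thesis
        using insert insert_pair_close[OF *] T by (fastforce simp: insert_commute)
    qed
  qed simp
  \<comment> \<open>The increment by \<open>C\<close> is a telescoping sum of one-element
    increments, each compared by \<open>one\<close>.\<close>
  have many: "g (A \<union> C) - g A \<le> g (X \<union> C) - g X"
    if "finite C" "A \<subseteq> X" "X \<union> C \<subseteq> {1..n}" "C \<inter> X = {}" for A X C
    using that
  proof (induction C rule: finite_induct)
    case (insert a C)
    have "finite X" using insert.prems by (meson finite_subset finite_atLeastAtMost le_supE)
    have "A \<union> C \<union> (X - A) = X \<union> C" using insert by auto
    moreover have "g (insert a (A \<union> C)) - g (A \<union> C)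
        \<le> g (insert a (A \<union> C \<union> (X - A))) - g (A \<union> C \<union> (X - A))"
      by (rule one) (use insert \<open>finite X\<close> in auto)
    ultimately show ?case using insert by auto
  qed simp
  show "supermodular n g"
    unfolding supermodular_def
  proof (intro ballI)
    fix I J assume IJ: "I \<in> Pow {1..n}" "J \<in> Pow {1..n}"
    have "g ((I \<inter> J) \<union> (I - J)) - g (I \<inter> J) \<le> g (J \<union> (I - J)) - g J"
      by (rule many) (use IJ in \<open>auto intro: finite_subset\<close>)
    moreover have "(I \<inter> J) \<union> (I - J) = I" "J \<union> (I - J) = I \<union> J" by auto
    ultimately show "g (I \<inter> J) + g (I \<union> J) \<ge> g I + g J" by simp
  qed
qed

lemma modular_iff_Tmap_zero: "modular n g \<longleftrightarrow> (\<forall>p\<in>close_pairs n. Tmap g p = 0)"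
proof -
  \<comment> \<open>Modularity of \<open>g\<close> means that \<open>g\<close> and its negative are
    supermodular; the negative is written as a linear combination so that \<open>Tmap_linear\<close>
    applies.\<close>
  have "supermodular n (\<lambda>K. -1 * g K + 0 * g K) \<longleftrightarrow>
      (\<forall>I\<in>Pow {1..n}. \<forall>J\<in>Pow {1..n}. g (I \<inter> J) + g (I \<union> J) \<le> g I + g J)"
    unfolding supermodular_def by (intro ball_cong refl) linarith
  then have "modular n g \<longleftrightarrow> supermodular n g \<and> supermodular n (\<lambda>K. -1 * g K + 0 * g K)"
    unfolding modular_def eq_iff[where 'a = real] ball_conj_distrib supermodular_def[of n g]
    by (simp only: conj_commute)
  also have "\<dots> \<longleftrightarrow> (\<forall>p\<in>close_pairs n. Tmap g p \<ge> 0 \<and> -1 * Tmap g p + 0 * Tmap g p \<ge> 0)"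
    unfolding supermodular_iff_Tmap_nonneg ball_conj_distrib by (simp only: Tmap_linear cong: ball_cong)
  also have "\<dots> \<longleftrightarrow> (\<forall>p\<in>close_pairs n. Tmap g p = 0)"
    by (intro ball_cong refl) linarith
  finally show ?thesis .
qed

text \<open>Adding one element to a set changes a modular function by a singleton value minus the
  value at the empty set. Hence normalised functions are determined by their
  \<open>Tmap\<close>.\<close>

lemma modular_eq_0:
  assumes g: "modular n g" "g {} = 0" "\<And>i. i \<in> {1..n} \<Longrightarrow> g {i} = 0" and K: "K \<subseteq> {1..n}"
  shows "g K = 0"
proof -
  have "finite K" using K finite_subset by blast
  then show ?thesis using K
  proof (induction K rule: finite_induct)
    case (insert a K)
    have "g ({a} \<inter> K) + g ({a} \<union> K) = g {a} + g K"
      using g(1) insert.prems unfolding modular_def by blast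
    then show ?case using insert g by simp
  qed (simp add: g)
qed

section \<open>Irreducibility as extremality of a ray\<close>

text \<open>A \<open>g\<close> whose \<open>Tmap\<close> vanishes wherever that of \<open>f\<close>
  does is a direction in which \<open>f\<close> can be moved slightly both ways within the cone, and
  irreducibility confines such moves to the ray of \<open>f\<close>. The factor \<open>d\<close> may
  have any sign.\<close>

lemma irreducible_kernel:
  assumes f: "irreducible_supermodular n f"
    and g: "\<And>p. p \<in> close_pairs n \<Longrightarrow> Tmap f p = 0 \<Longrightarrow> Tmap g p = 0"
  obtains d where "\<And>p. p \<in> close_pairs n \<Longrightarrow> Tmap g p = d * Tmap f p"
proof -
  have f0: "Tmap f p \<ge> 0" if "p \<in> close_pairs n" for p
    using f that unfolding irreducible_supermodular_def supermodular_iff_Tmap_nonneg by blast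
  \<comment> \<open>Pairs with \<open>Tmap f p = 0\<close> contribute the harmless quotient
    \<open>0\<close>; the inserted \<open>1\<close> makes \<open>M\<close> positive.\<close>
  define M where "M = Max (insert 1 ((\<lambda>p. \<bar>Tmap g p\<bar> / Tmap f p) ` close_pairs n))"
  have M1: "M \<ge> 1" unfolding M_def using finite_close_pairs by (intro Max_ge) auto
  have M: "\<bar>Tmap g p\<bar> \<le> M * Tmap f p" if p: "p \<in> close_pairs n" for p
  proof (cases "Tmap f p = 0")
    case False
    have "\<bar>Tmap g p\<bar> / Tmap f p \<le> M"
      unfolding M_def using finite_close_pairs p by (intro Max_ge) auto
    then show ?thesis using False f0[OF p] by (simp add: field_simps)
  qed (use g p in auto)
  \<comment> \<open>\<open>f\<close> is the sum of its two perturbations along \<open>\<plusminus>g\<close>, both supermodular by the choice of \<open>M\<close>.\<close>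
  define g1 where "g1 = (\<lambda>K. 1/2 * f K + 1/(2*M) * g K)"
  define g2 where "g2 = (\<lambda>K. 1/2 * f K + (- 1/(2*M)) * g K)"
  have T1: "Tmap g1 p = 1/2 * Tmap f p + 1/(2*M) * Tmap g p"
    and T2: "Tmap g2 p = 1/2 * Tmap f p + (- 1/(2*M)) * Tmap g p" if "p \<in> close_pairs n" for p
    unfolding g1_def g2_def by (rule Tmap_linear[OF that])+
  have "supermodular n g1" "supermodular n g2"
    unfolding supermodular_iff_Tmap_nonneg using M M1
    by (force simp: T1 T2 field_simps)+
  moreover have "\<forall>I\<in>Pow {1..n}. f I = g1 I + g2 I" by (simp add: g1_def g2_def)
  ultimately obtain c where "modular n (\<lambda>I. g1 I - c * f I)"
    using f unfolding irreducible_supermodular_def by blast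
  then have "modular n (\<lambda>I. 1 * g1 I + (-c) * f I)" by simp
  then have c: "Tmap g1 p = c * Tmap f p" if p: "p \<in> close_pairs n" for p
    using Tmap_linear[OF p, of 1 g1 "-c" f] unfolding modular_iff_Tmap_zero
    by (simp add: p)
  show thesis
  \<comment> \<open>The factor comes from solving
    \<open>1/2 * Tmap f p + 1/(2*M) * Tmap g p = c * Tmap f p\<close> for
    \<open>Tmap g p\<close>.\<close>
  proof (rule that[of "M * (2 * c - 1)"])
    fix p assume p: "p \<in> close_pairs n"
    show "Tmap g p = M * (2 * c - 1) * Tmap f p"
      using T1[OF p] c[OF p] M1 by (simp add: field_simps)
  qed
qed

section \<open>Matrix rows, scaling and weights\<close>

text \<open>The row of the matrix of \<open>Tmap\<close> at \<open>p\<close>, kept integer-valued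
  for the pigeonhole argument.\<close>

definition close_row :: "nat set set \<Rightarrow> nat set \<Rightarrow> int" where
  "close_row p K = of_bool (K = \<Inter>p) + of_bool (K = \<Union>p) - of_bool (K \<in> p)"

lemma close_row_sum:
  fixes g :: "nat set \<Rightarrow> real"
  assumes p: "p \<in> close_pairs n"
  shows "(\<Sum>K\<in>Pow {1..n}. real_of_int (close_row p K) * g K) = Tmap g p"
    and "(\<Sum>K\<in>Pow {1..n}. \<bar>close_row p K\<bar>) \<le> 4"
proof -
  obtain K a b where *: "insert a (insert b K) \<subseteq> {1..n}" and pK: "p = {insert a K, insert b K}"
    using p by (rule close_pairsE)
  have sub: "p \<subseteq> Pow {1..n}" "\<Inter>p \<subseteq> {1..n}" "\<Union>p \<subseteq> {1..n}" using * unfolding pK by blast+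
  have card: "card p \<le> 2" by (simp add: pK card_insert_if)
  have Int: "Pow {1..n} \<inter> {K. K = \<Inter>p} = {\<Inter>p}" "Pow {1..n} \<inter> {K. K = \<Union>p} = {\<Union>p}"
    "Pow {1..n} \<inter> {K. K \<in> p} = p" using sub by auto
  have of_bool_mult: "of_bool P * x = (if P then x else 0)" for P and x :: real by simp
  show "(\<Sum>K\<in>Pow {1..n}. real_of_int (close_row p K) * g K) = Tmap g p"
    unfolding close_row_def Tmap_def using Int
    by (simp add: algebra_simps sum.distrib sum_subtractf sum.If_cases of_bool_mult del: of_bool_eq)
  have "(\<Sum>K\<in>Pow {1..n}. \<bar>close_row p K\<bar>)
      \<le> (\<Sum>K\<in>Pow {1..n}. of_bool (K = \<Inter>p) + of_bool (K = \<Union>p) + of_bool (K \<in> p))"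
    by (intro sum_mono) (simp add: close_row_def)
  also have "\<dots> = 2 + int (card p)"
    unfolding sum.distrib using Int by (simp add: sum_of_bool_eq)
  finally show "(\<Sum>K\<in>Pow {1..n}. \<bar>close_row p K\<bar>) \<le> 4" using card by simp
qed

text \<open>Dividing an integral multiple of \<open>Tmap f\<close> by the gcd \<open>G\<close> of
  its entries makes it primitive, so the scaling factor exists and equals \<open>d / G\<close> with
  \<open>G \<ge> 1\<close>.\<close>

lemma scaling_le:
  assumes d: "d > 0" and int: "\<And>p. p \<in> close_pairs n \<Longrightarrow> d * Tmap f p \<in> \<int>"
    and nz: "\<exists>p\<in>close_pairs n. Tmap f p \<noteq> 0"
  shows "0 < scaling n f" "scaling n f \<le> d"
proof -
  define A where "A p = \<lfloor>d * Tmap f p\<rfloor>" for p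
  define G where "G = Gcd (A ` close_pairs n)"
  have A: "d * Tmap f p = of_int (A p)" if "p \<in> close_pairs n" for p
    using int[OF that] by (auto simp: A_def elim: Ints_cases)
  have "G \<noteq> 0"
    unfolding G_def Gcd_0_iff using nz A d by fastforce
  moreover have "G \<ge> 0" unfolding G_def by simp
  ultimately have G: "G \<ge> 1" by simp
  define C where "C p = A p div G" for p
  have C: "A p = G * C p" if "p \<in> close_pairs n" for p
    using that unfolding C_def G_def by (simp add: Gcd_dvd)
  have "A ` close_pairs n = (*) G ` C ` close_pairs n"
    unfolding image_image using C by (intro image_cong) auto
  \<comment> \<open>The gcd is homogeneous, so the quotients by \<open>G\<close> have gcd
    \<open>1\<close>.\<close>
  then have "G = \<bar>G * Gcd (C ` close_pairs n)\<bar>"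
    using Gcd_mult[of G "C ` close_pairs n"] by (simp add: G_def)
  then have GC: "Gcd (C ` close_pairs n) = 1" using G by (simp add: abs_mult)
  have eq: "d / G * Tmap f p = of_int (C p)" if "p \<in> close_pairs n" for p
    using A[OF that] C[OF that] G by (simp add: field_simps)
  have "(\<lambda>p. \<lfloor>d / G * Tmap f p\<rfloor>) ` close_pairs n = C ` close_pairs n"
    by (intro image_cong) (simp_all only: eq floor_of_int)
  then have "primitive_integral n (\<lambda>p. d / G * Tmap f p)"
    unfolding primitive_integral_def using GC eq by (metis Ints_of_int)
  moreover have pos: "d / G > 0" using d G by simp
  ultimately have eq: "scaling n f = d / G"
    unfolding scaling_def by (intro the_equality) (auto intro: primitive_scaling_unique)
  show "0 < scaling n f" unfolding eq by (rule pos)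
  show "scaling n f \<le> d" unfolding eq using d G by (simp add: divide_le_eq)
qed

text \<open>The transposition of \<open>1\<close> and \<open>i\<close> is a permutation with first
  entry \<open>i\<close>, and the factor \<open>c\<close> moves inside \<open>Tmap\<close>.\<close>

lemma weight_eq:
  assumes "i \<in> {1..n}"
  shows "weight n (\<lambda>p. c * Tmap f p) i = c * (f {1..n} + f {} - f {i} - f ({1..n} - {i}))"
proof -
  have \<sigma>: "transpose 1 i permutes {1..n}" and n: "n \<ge> 1"
    using assms by (auto intro: permutes_swap_id)
  have "(\<lambda>p. c * Tmap f p) = Tmap (\<lambda>K. c * f K)"
    by (simp add: Tmap_def fun_eq_iff algebra_simps sum_distrib_left)
  then show ?thesis
    using weight_Tmap[OF \<sigma> n, of "\<lambda>K. c * f K"] P_sum_Tmap[OF \<sigma> n, of "\<lambda>K. c * f K"]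
    by (simp add: algebra_simps)
qed

section \<open>A small integer function on the ray of \<open>f\<close>\<close>

lemma irreducible_small_multiple:
  assumes f: "irreducible_supermodular n f"
  obtains g :: "nat set \<Rightarrow> int" and d where "d > 0"
    "\<And>p. p \<in> close_pairs n \<Longrightarrow> Tmap (\<lambda>K. real_of_int (g K)) p = d * Tmap f p"
    "g {} = 0" "\<And>i. i \<in> {1..n} \<Longrightarrow> g {i} = 0"
    "\<And>K. K \<subseteq> {1..n} \<Longrightarrow> \<bar>g K\<bar> \<le> 4 ^ (2 ^ n - 1)"
proof -
  define S where "S = Pow {1..n}"
  let ?e = "\<lambda>K0 K. of_bool (K = K0) :: int"
  define Z where "Z = insert {} ((\<lambda>i. {i}) ` {1..n})"
  \<comment> \<open>The unit rows of \<open>Z\<close> impose the normalisation; the other rows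
    impose the zeros of \<open>Tmap f\<close>.\<close>
  define R where "R = close_row ` {p \<in> close_pairs n. Tmap f p = 0} \<union> ?e ` Z"
  \<comment> \<open>A modular correction: adding it to \<open>f\<close> cancels the values on the
    empty set and on singletons without changing \<open>Tmap\<close> on close pairs.\<close>
  define h where "h K = - f {} - (\<Sum>i\<in>K. f {i} - f {})" for K :: "nat set"
  define f\<^sub>0 where "f\<^sub>0 = (\<lambda>K. 1 * f K + 1 * h K)"
  have S: "finite S" "card S = 2 ^ n" and ZS: "Z \<subseteq> S" by (auto simp: S_def Z_def card_Pow)
  have e_sum: "(\<Sum>K\<in>S. real_of_int (?e K0 K) * g K) = g K0" if "K0 \<in> Z" for K0 and g :: "nat set \<Rightarrow> real"
    using that ZS S(1) by (subst sum.remove[of _ K0]) auto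
  have "Tmap h p = 0" if "p \<in> close_pairs n" for p
    using that
  proof (elim close_pairsE)
    fix K a b assume *: "a \<noteq> b" "a \<notin> K" "b \<notin> K" "insert a (insert b K) \<subseteq> {1..n}"
      "p = {insert a K, insert b K}"
    have "finite K" using *(4) finite_subset by auto
    then show ?thesis
      unfolding *(5) insert_pair_close(2)[OF *(1-4)] using *(1-3) by (simp add: h_def)
  qed
  then have Tf\<^sub>0: "Tmap f\<^sub>0 p = Tmap f p" if "p \<in> close_pairs n" for p
    using that Tmap_linear[OF that, of 1 f 1 h] by (simp add: f\<^sub>0_def)
  have nz: "\<exists>K\<in>S. f\<^sub>0 K \<noteq> 0"
  proof (rule ccontr)
    assume "\<not> ?thesis"
    then have "modular n f\<^sub>0" unfolding modular_def S_def by (auto simp: le_infI1)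
    then show False
      using f Tf\<^sub>0 unfolding irreducible_supermodular_def modular_iff_Tmap_zero by simp
  qed
  have ker: "(\<Sum>K\<in>S. real_of_int (r K) * f\<^sub>0 K) = 0" if r: "r \<in> R" for r
  proof -
    consider p where "p \<in> close_pairs n" "Tmap f p = 0" "r = close_row p"
      | K0 where "K0 \<in> Z" "r = ?e K0" using r unfolding R_def by blast
    then show ?thesis
    proof cases
      case 1
      then show ?thesis unfolding S_def by (simp only: close_row_sum(1) Tf\<^sub>0)
    next
      case 2
      then show ?thesis by (simp only: e_sum) (auto simp: Z_def f\<^sub>0_def h_def)
    qed
  qed
  have bound: "(\<Sum>K\<in>S. \<bar>r K\<bar>) \<le> int 4" if r: "r \<in> R" for r
  proof -
    consider p where "p \<in> close_pairs n" "r = close_row p"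
      | K0 where "K0 \<in> Z" "r = ?e K0" using r unfolding R_def by blast
    then show ?thesis
    proof cases
      case 1
      then show ?thesis using close_row_sum(2)[of p n] by (simp add: S_def)
    next
      case 2
      then have "S \<inter> {K. K = K0} = {K0}" using ZS by auto
      then show ?thesis using 2 S by (simp add: sum_of_bool_eq del: of_bool_eq)
    qed
  qed
  obtain x :: "nat set \<Rightarrow> int" where x: "\<exists>K\<in>S. x K \<noteq> 0"
    "\<And>K. K \<in> S \<Longrightarrow> \<bar>x K\<bar> \<le> int (4 ^ (card S - 1))" "\<And>r. r \<in> R \<Longrightarrow> (\<Sum>K\<in>S. r K * x K) = 0"
    by (rule small_integer_solution[OF S(1) one_le_numeral bound nz ker]) (assumption | rule that)+
  have xR: "(\<Sum>K\<in>S. real_of_int (r K) * real_of_int (x K)) = 0" if "r \<in> R" for r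
    using arg_cong[OF x(3)[OF that], of real_of_int] by simp
  have x0: "x K = 0" if "K \<in> Z" for K
    using e_sum[OF that, of "\<lambda>K. of_int (x K)"] xR[of "?e K"] that unfolding R_def by simp
  have "Tmap (\<lambda>K. real_of_int (x K)) p = 0" if "p \<in> close_pairs n" "Tmap f p = 0" for p
    using xR[of "close_row p"] that
      close_row_sum(1)[OF that(1), of "\<lambda>K. of_int (x K)"] unfolding R_def S_def by simp
  then obtain d where d: "\<And>p. p \<in> close_pairs n \<Longrightarrow> Tmap (\<lambda>K. real_of_int (x K)) p = d * Tmap f p"
    by (rule irreducible_kernel[OF f]) (assumption | rule that)+
  \<comment> \<open>With \<open>d = 0\<close> the solution would be modular and normalised, hence
    zero on \<open>S\<close>.\<close>
  have "d \<noteq> 0"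
  proof
    assume "d = 0"
    then have "modular n (\<lambda>K. real_of_int (x K))" unfolding modular_iff_Tmap_zero using d by simp
    then have "real_of_int (x K) = 0" if "K \<in> S" for K
      by (rule modular_eq_0) (use x0 that in \<open>auto simp: Z_def S_def\<close>)
    with x(1) show False by auto
  qed
  \<comment> \<open>The solution is determined only up to sign; \<open>u\<close> makes the multiple
    of \<open>Tmap f\<close> positive.\<close>
  define u :: int where "u = (if d > 0 then 1 else -1)"
  show thesis
  proof (rule that[of "real_of_int u * d" "\<lambda>K. u * x K"])
    show "real_of_int u * d > 0" using \<open>d \<noteq> 0\<close> by (auto simp: u_def)
    show "Tmap (\<lambda>K. real_of_int (u * x K)) p = real_of_int u * d * Tmap f p"
      if "p \<in> close_pairs n" for p
      using Tmap_linear[OF that, of "real_of_int u" "\<lambda>K. real_of_int (x K)" 0 "\<lambda>_. 0"] d[OF that]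
      by simp
    show "u * x {} = 0" "\<And>i. i \<in> {1..n} \<Longrightarrow> u * x {i} = 0" using x0 by (auto simp: Z_def)
    show "\<bar>u * x K\<bar> \<le> 4 ^ (2 ^ n - 1)" if "K \<subseteq> {1..n}" for K
      using x(2)[of K] that S(2) by (auto simp: u_def S_def abs_mult)
  qed
qed

section \<open>The complexity bound\<close>

theorem theorem5p2:
  fixes n :: nat and f :: "nat set \<Rightarrow> real"
  assumes "irreducible_supermodular n f"
  shows "complexity n f \<le> 2 ^ (n ^ 2 * 2 ^ n)"
proof -
  have nonmod: "\<not> modular n f" using assms unfolding irreducible_supermodular_def by blast
  obtain p where p: "p \<in> close_pairs n" "Tmap f p \<noteq> 0"
    using nonmod unfolding modular_iff_Tmap_zero by blast
  \<comment> \<open>A close pair involves two distinct elements, so \<open>n \<ge> 2\<close>. This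
    serves the final comparison of exponents and makes the set of weights nonempty.\<close>
  obtain K a b where "a \<noteq> b" "insert a (insert b K) \<subseteq> {1..n}" using p(1) by (rule close_pairsE)
  then have "card {a, b} \<le> card {1..n}" by (intro card_mono) auto
  with \<open>a \<noteq> b\<close> have n: "n \<ge> 2" by simp
  obtain g :: "nat set \<Rightarrow> int" and d where d: "d > 0"
    and g: "\<And>p. p \<in> close_pairs n \<Longrightarrow> Tmap (\<lambda>K. real_of_int (g K)) p = d * Tmap f p"
      "g {} = 0" "\<And>i. i \<in> {1..n} \<Longrightarrow> g {i} = 0"
      "\<And>K. K \<subseteq> {1..n} \<Longrightarrow> \<bar>g K\<bar> \<le> 4 ^ (2 ^ n - 1)"
    by (rule irreducible_small_multiple[OF assms]) (assumption | rule that)+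
  have int: "d * Tmap f q \<in> \<int>" if "q \<in> close_pairs n" for q
  proof -
    have "Tmap (\<lambda>K. real_of_int (g K)) q \<in> \<int>"
      unfolding Tmap_def by (intro Ints_add Ints_diff Ints_sum Ints_of_int)
    then show ?thesis using g(1)[OF that] by simp
  qed
  have c: "0 < scaling n f" "scaling n f \<le> d"
    using scaling_le[OF d int bexI[of "\<lambda>p. Tmap f p \<noteq> 0", OF p(2,1)]] by simp_all
  have "weight n (\<lambda>p. scaling n f * Tmap f p) i \<le> 2 ^ (n ^ 2 * 2 ^ n)" if i: "i \<in> {1..n}" for i
  proof -
    have \<sigma>: "transpose 1 i permutes {1..n}" and n1: "n \<ge> 1"
      using i by (auto intro: permutes_swap_id)
    define w where "w = f {1..n} + f {} - f {i} - f ({1..n} - {i})"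
    have "d * w = d * P_sum n (transpose 1 i) (Tmap f)"
      using P_sum_Tmap[OF \<sigma> n1, of f] by (simp add: w_def)
    also have "\<dots> = P_sum n (transpose 1 i) (Tmap (\<lambda>K. real_of_int (g K)))"
      unfolding P_sum_def sum_distrib_left
    proof (intro sum.cong refl)
      fix r assume "r \<in> {1..n - 1}"
      then have "1 \<le> r" "r < n" by auto
      from g(1)[OF I_J_set_pair(1)[OF \<sigma> this]]
      show "d * Tmap f {I_set (transpose 1 i) r, J_set (transpose 1 i) r} =
          Tmap (\<lambda>K. real_of_int (g K)) {I_set (transpose 1 i) r, J_set (transpose 1 i) r}" ..
    qed
    \<comment> \<open>The weight has four terms; the normalisation removes those at the empty set
      and at \<open>{i}\<close>.\<close>
    also have "\<dots> = real_of_int (g {1..n} - g ({1..n} - {i}))"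
      using P_sum_Tmap[OF \<sigma> n1, of "\<lambda>K. real_of_int (g K)"] g(2) g(3)[OF i] by simp
    also have "\<dots> \<le> real_of_int (4 ^ (2 ^ n))"
    proof -
      \<comment> \<open>Two entries of the given size would need only a factor \<open>2\<close>;
        rounding it up to \<open>4\<close> completes the power.\<close>
      have "g {1..n} - g ({1..n} - {i}) \<le> 4 * 4 ^ (2 ^ n - 1)"
        using g(4)[OF order_refl] g(4)[of "{1..n} - {i}", OF Diff_subset] by linarith
      also have "\<dots> = 4 ^ (2 ^ n)" by (rule power_minus_mult[of "2 ^ n", THEN trans[OF mult.commute]]) simp
      finally show ?thesis by (simp only: of_int_le_iff)
    qed
    finally have dw: "d * w \<le> 4 ^ (2 ^ n)" by (simp only: of_int_power of_int_numeral)
    \<comment> \<open>The maximum with \<open>0\<close> covers a negative \<open>w\<close>, for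
      which \<open>scaling n f \<le> d\<close> would work in the wrong direction.\<close>
    have "scaling n f * w \<le> max 0 (d * w)"
      using c by (cases "w \<ge> 0") (auto simp: le_max_iff_disj mult_right_mono mult_nonneg_nonpos)
    also have "\<dots> \<le> 4 ^ (2 ^ n)" using dw by simp
    also have "\<dots> = (2\<^sup>2) ^ (2 ^ n)" by simp
    also have "\<dots> = 2 ^ (2 * 2 ^ n)" by (rule power_mult[symmetric])
    also have "\<dots> \<le> 2 ^ (n ^ 2 * 2 ^ n)"
    proof (intro power_increasing mult_right_mono)
      show "2 \<le> n ^ 2" using n by (rule order_trans) (simp add: power2_eq_square)
    qed auto
    finally show ?thesis unfolding weight_eq[OF i] w_def .
  qed
  then show ?thesis unfolding complexity_def using n by (subst Max_le_iff) auto
qed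

end
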